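(* Let $c=(c_n)_{n\ge 0}$ be a sequence of numbers and let $p=\mathcal{A}(c)$ be its aerated sequence, i.e. $p_n=c_{n/2}$ if $n$ is even and $p_n=0$ if $n$ is odd. Then for every integer $n\ge 0$, $$\det[p_{i+j}]_{0\le i,j\le n}=\det[c_{i+j}]_{0\le i,j\le \lfloor n/2\rfloor}\cdot \det[c_{i+j+1}]_{0\le i,j\le \lfloor (n-1)/2\rfloor}.$$ In terms of Hankel transforms: if $g=\mathcal{H}(p)$, $h=\mathcal{H}(c)$ and $h^*=\mathcal{H}(c^* )$, where $c^*=(c_{n+1})_{n\ge 0}$ is the shifted sequence, then $g_n=h_{\lfloor n/2\rfloor}\,h^*_{\lfloor (n-1)/2\rfloor}$ for every $n\ge 0$.
   Context: The Hankel transform of a sequence $a=(a_n)_{n\ge 0}$ is the sequence $\mathcal{H}(a)=(h_n)_{n\ge 0}$ with $h_n=\det[a_{i+j}]_{0\le i,j\le n}$. The aerating transform of $c$ is $\mathcal{A}(c)=(c_0,0,c_1,0,c_2,0,\ldots)$. The determinant of the empty matrix (index range $0\le i,j\le -1$) is $1$; accordingly $h^*_{-1}=1$. *)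

theory Defs
  imports Complex_Main "Jordan_Normal_Form.Determinant"
begin

text \<open>The matrix $[f(i,j)]_{0 \le i,j \le n}$. The upper index is inclusive and an integer,
  so that $n = -1$ gives the empty matrix, whose determinant is 1.\<close>

definition sq_mat_upto :: "int \<Rightarrow> (nat \<Rightarrow> nat \<Rightarrow> 'a) \<Rightarrow> 'a mat" where
  "sq_mat_upto n f = mat (nat (n + 1)) (nat (n + 1)) (\<lambda>(i, j). f i j)"

text \<open>The terms of the transformed sequence are those with index \<open>n \<ge> 0\<close>; the index is an
  integer to include the convention that the term of index $-1$ is 1.\<close>

definition hankel_transform :: "(nat \<Rightarrow> 'a::comm_ring_1) \<Rightarrow> int \<Rightarrow> 'a" where
  "hankel_transform a n = det (sq_mat_upto n (\<lambda>i j. a (i + j)))"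

definition aerate :: "(nat \<Rightarrow> 'a::zero) \<Rightarrow> nat \<Rightarrow> 'a" where
  "aerate c n = (if even n then c (n div 2) else 0)"

definition shift_seq :: "(nat \<Rightarrow> 'a) \<Rightarrow> nat \<Rightarrow> 'a" where
  "shift_seq c n = c (n + 1)"

lemma hankel_transform_minus_one: "hankel_transform a (- 1) = 1"
  by (simp add: hankel_transform_def sq_mat_upto_def det_dim_zero)

end

theory Submission
  imports Defs
begin

text \<open>Listing the even indices before the odd ones, simultaneously for rows and columns, leaves the
  determinant unchanged and makes the Hankel matrix of the aerated sequence block diagonal: the
  entry at \<open>(i, j)\<close> vanishes when \<open>i\<close> and \<open>j\<close> have different parity, and the even-even and odd-odd
  blocks are the Hankel matrices of \<open>c\<close> and of the shifted sequence.\<close>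

text \<open>The same permutation acts on rows and on columns, so its sign enters twice and squares
  to 1.\<close>

lemma det_permute_rows_cols:
  fixes A :: "'a::comm_ring_1 mat"
  assumes A: "A \<in> carrier_mat n n" and p: "p permutes {0..<n}"
  shows "det (mat n n (\<lambda>(i, j). A $$ (p i, p j))) = det A"
proof -
  \<comment> \<open>Transposing \<open>B\<close> gives \<open>A\<close> with only its columns
    permuted, so the row rule covers both permutations.\<close>
  define B where "B = mat n n (\<lambda>(i, j). transpose_mat A $$ (p i, j))"
  have B: "B \<in> carrier_mat n n" by (simp add: B_def)
  have lt: "p i < n" if "i < n" for i
    using permutes_in_image[OF p, of i] that by simp
  have "mat n n (\<lambda>(i, j). A $$ (p i, p j)) = mat n n (\<lambda>(i, j). transpose_mat B $$ (p i, j))"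
    using A lt by (intro eq_matI) (auto simp: B_def)
  then have "det (mat n n (\<lambda>(i, j). A $$ (p i, p j))) = signof p * det (transpose_mat B)"
    using det_permute_rows[OF _ p, of "transpose_mat B"] B by simp
  also have "det (transpose_mat B) = signof p * det A"
    using det_permute_rows[OF _ p, of "transpose_mat A"] A
    unfolding det_transpose[OF B] det_transpose[OF A] by (simp add: B_def)
  also have "signof p * (signof p * det A) = det A"
    by (simp add: sign_def)
  finally show ?thesis .
qed

text \<open>Induction on \<open>k\<close> splits off the last row and column of the identity block,
  a 1-by-1 corner each time. The rule for a single zero column then suffices, over any commutative
  ring.\<close>

lemma det_four_block_mat_one_lower_right:
  fixes A :: "'a::comm_ring_1 mat"
  assumes A: "A \<in> carrier_mat m m"
  shows "det (four_block_mat A (0\<^sub>m m k) (0\<^sub>m k m) (1\<^sub>m k)) = det A"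
proof (induction k)
  case 0
  have "four_block_mat A (0\<^sub>m m 0) (0\<^sub>m 0 m) (1\<^sub>m 0) = A"
    using A by (intro eq_matI) auto
  then show ?case by simp
next
  case (Suc k)
  let ?B = "four_block_mat A (0\<^sub>m m k) (0\<^sub>m k m) (1\<^sub>m k)"
  have "four_block_mat A (0\<^sub>m m (Suc k)) (0\<^sub>m (Suc k) m) (1\<^sub>m (Suc k))
      = four_block_mat ?B (0\<^sub>m (m + k) 1) (0\<^sub>m 1 (m + k)) (1\<^sub>m 1)"
    using A by (intro eq_matI) auto
  moreover have "det (four_block_mat ?B (0\<^sub>m (m + k) 1) (0\<^sub>m 1 (m + k)) (1\<^sub>m 1)) = det ?B * det (1\<^sub>m 1)"
    using A by (intro det_four_block_mat_upper_right_zero_col) auto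
  ultimately show ?case using Suc by simp
qed

text \<open>The mirror image: the induction splits off the first row and column.\<close>

lemma det_four_block_mat_one_upper_left:
  fixes D :: "'a::comm_ring_1 mat"
  assumes D: "D \<in> carrier_mat m m"
  shows "det (four_block_mat (1\<^sub>m k) (0\<^sub>m k m) (0\<^sub>m m k) D) = det D"
proof (induction k)
  case 0
  have "four_block_mat (1\<^sub>m 0) (0\<^sub>m 0 m) (0\<^sub>m m 0) D = D"
    using D by (intro eq_matI) auto
  then show ?case by simp
next
  case (Suc k)
  let ?B = "four_block_mat (1\<^sub>m k) (0\<^sub>m k m) (0\<^sub>m m k) D"
  have "four_block_mat (1\<^sub>m (Suc k)) (0\<^sub>m (Suc k) m) (0\<^sub>m m (Suc k)) D
      = four_block_mat (1\<^sub>m 1) (0\<^sub>m 1 (k + m)) (0\<^sub>m (k + m) 1) ?B"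
    using D by (intro eq_matI) auto
  moreover have "det (four_block_mat (1\<^sub>m 1) (0\<^sub>m 1 (k + m)) (0\<^sub>m (k + m) 1) ?B) = det (1\<^sub>m 1) * det ?B"
    using D by (intro det_four_block_mat_lower_left_zero_col) auto
  ultimately show ?case using Suc by simp
qed

text \<open>The library proves \<open>det_four_block_mat_upper_right_zero\<close> only over integral domains; here the
  factorization \<open>diag(A, D) = diag(A, 1) diag(1, D)\<close> avoids cancellation.\<close>

lemma det_four_block_mat_diagonal:
  fixes A D :: "'a::comm_ring_1 mat"
  assumes A: "A \<in> carrier_mat m m" and D: "D \<in> carrier_mat k k"
  shows "det (four_block_mat A (0\<^sub>m m k) (0\<^sub>m k m) D) = det A * det D"
proof -
  let ?P = "four_block_mat A (0\<^sub>m m k) (0\<^sub>m k m) (1\<^sub>m k)"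
  let ?Q = "four_block_mat (1\<^sub>m m) (0\<^sub>m m k) (0\<^sub>m k m) D"
  have "?P * ?Q = four_block_mat A (0\<^sub>m m k) (0\<^sub>m k m) D"
    using A D by (subst mult_four_block_mat[of _ m m _ k _ k _ _ m _ k]) auto
  moreover have "det (?P * ?Q) = det ?P * det ?Q"
    using A D by (intro det_mult[of _ "m + k"]) auto
  ultimately show ?thesis
    using det_four_block_mat_one_lower_right[OF A] det_four_block_mat_one_upper_left[OF D] by simp
qed

text \<open>Lists 0, 2, 4, ... and then 1, 3, 5, ... below \<open>N\<close>; there are
  \<open>(N + 1) div 2\<close> even indices below \<open>N\<close>. The identity branch beyond
  \<open>N\<close> is what \<open>permutes\<close> demands.\<close>

definition evens_first :: "nat \<Rightarrow> nat \<Rightarrow> nat" where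
  "evens_first N i =
    (if i < (N + 1) div 2 then 2 * i
     else if i < N then 2 * (i - (N + 1) div 2) + 1
     else i)"

lemma evens_first_permutes: "evens_first N permutes {0..<N}"
proof (rule bij_imp_permutes)
  have inj: "inj_on (evens_first N) {0..<N}"
  proof (rule inj_onI)
    fix x y
    assume "x \<in> {0..<N}" "y \<in> {0..<N}" "evens_first N x = evens_first N y"
    then show "x = y"
      \<comment> \<open>Within a branch the map is visibly injective; values from different branches
        differ in parity.\<close>
      by (auto simp: evens_first_def split: if_splits dest: arg_cong[of _ _ even])
  qed
  have "evens_first N ` {0..<N} \<subseteq> {0..<N}"
    by (auto simp: evens_first_def)
  then have "evens_first N ` {0..<N} = {0..<N}"
    using inj by (intro endo_inj_surj) auto
  with inj show "bij_betw (evens_first N) {0..<N} {0..<N}"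
    by (simp add: bij_betw_def)
qed (auto simp: evens_first_def)

text \<open>Phrased by the size \<open>N\<close> instead of the last index, so that the block sizes
  are plain natural quotients.\<close>

lemma det_hankel_aerate:
  fixes c :: "nat \<Rightarrow> 'a::comm_ring_1"
  shows "det (mat N N (\<lambda>(i, j). aerate c (i + j)))
    = det (mat ((N + 1) div 2) ((N + 1) div 2) (\<lambda>(i, j). c (i + j)))
      * det (mat (N div 2) (N div 2) (\<lambda>(i, j). c (i + j + 1)))"
proof -
  \<comment> \<open>\<open>m\<close> counts the even and \<open>k\<close> the odd indices below
    \<open>N\<close>.\<close>
  define m where "m = (N + 1) div 2"
  define k where "k = N div 2"
  have N: "N = m + k" unfolding m_def k_def by presburger
  let ?H = "mat N N (\<lambda>(i, j). aerate c (i + j))"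
  let ?A = "mat m m (\<lambda>(i, j). c (i + j))"
  let ?D = "mat k k (\<lambda>(i, j). c (i + j + 1))"
  let ?p = "evens_first N"
  have lt: "?p i < N" if "i < N" for i
    using permutes_in_image[OF evens_first_permutes, of N i] that by simp
  have low: "?p i = 2 * i" if "i < m" for i
    using that by (simp add: evens_first_def m_def)
  have high: "?p i = 2 * (i - m) + 1" if "\<not> i < m" "i < N" for i
    using that by (simp add: evens_first_def m_def)
  have "mat N N (\<lambda>(i, j). ?H $$ (?p i, ?p j)) = four_block_mat ?A (0\<^sub>m m k) (0\<^sub>m k m) ?D"
  proof (rule eq_matI)
    fix i j
    assume "i < dim_row (four_block_mat ?A (0\<^sub>m m k) (0\<^sub>m k m) ?D)"
      and "j < dim_col (four_block_mat ?A (0\<^sub>m m k) (0\<^sub>m k m) ?D)"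
    then have ij: "i < N" "j < N" by (simp_all add: N)
    have "aerate c (?p i + ?p j) =
      (if i < m then if j < m then c (i + j) else 0
       else if j < m then 0 else c (i - m + (j - m) + 1))"
    proof -
      have ee: "aerate c (2 * a + 2 * b) = c (a + b)" for a b
        by (simp add: aerate_def)
      have eo: "aerate c (2 * a + (2 * b + 1)) = 0" "aerate c (2 * a + 1 + 2 * b) = 0" for a b
        by (simp_all add: aerate_def)
      \<comment> \<open>Two odd indices add up to \<open>2 * (a + b + 1)\<close>: this is where the
        shift of \<open>c\<close> comes from.\<close>
      have oo: "aerate c (2 * a + 1 + (2 * b + 1)) = c (a + b + 1)" for a b
        by (simp add: aerate_def)
      show ?thesis
        using ij by (cases "i < m"; cases "j < m") (simp_all only: low high ee eo oo if_True if_False not_False_eq_True)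
    qed
    then show "mat N N (\<lambda>(i, j). ?H $$ (?p i, ?p j)) $$ (i, j)
      = four_block_mat ?A (0\<^sub>m m k) (0\<^sub>m k m) ?D $$ (i, j)"
      using ij lt by (auto simp: N)
  qed (simp_all add: N)
  then have "det ?H = det (four_block_mat ?A (0\<^sub>m m k) (0\<^sub>m k m) ?D)"
    using det_permute_rows_cols[OF _ evens_first_permutes, of ?H N] by simp
  also have "\<dots> = det ?A * det ?D"
    by (rule det_four_block_mat_diagonal) auto
  finally show ?thesis unfolding m_def k_def .
qed

theorem theorem4p1:
  fixes c :: "nat \<Rightarrow> 'a::comm_ring_1"
  shows "(\<forall>n::nat.
            det (sq_mat_upto (int n) (\<lambda>i j. aerate c (i + j)))
            = det (sq_mat_upto \<lfloor>real n / 2\<rfloor> (\<lambda>i j. c (i + j)))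
              * det (sq_mat_upto \<lfloor>(real n - 1) / 2\<rfloor> (\<lambda>i j. c (i + j + 1))))
       \<and> (\<forall>n::nat.
            hankel_transform (aerate c) (int n)
            = hankel_transform c \<lfloor>real n / 2\<rfloor>
              * hankel_transform (shift_seq c) \<lfloor>(real n - 1) / 2\<rfloor>)"
proof -
  have even_size: "nat (\<lfloor>real n / 2\<rfloor> + 1) = (Suc n + 1) div 2" for n
    using floor_divide_of_int_eq[of "int n" 2, where 'a = real] by simp
  \<comment> \<open>The quotient is taken over the integers because \<open>n - 1\<close> may be
    negative: for \<open>n = 0\<close> the floor is -1, the size is 0, and the factor is the empty
    determinant 1.\<close>
  have odd_size: "nat (\<lfloor>(real n - 1) / 2\<rfloor> + 1) = Suc n div 2" for n
    using floor_divide_of_int_eq[of "int n - 1" 2, where 'a = real] by simp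
  have size: "nat (int n + 1) = Suc n" for n by simp
  have "det (sq_mat_upto (int n) (\<lambda>i j. aerate c (i + j)))
      = det (sq_mat_upto \<lfloor>real n / 2\<rfloor> (\<lambda>i j. c (i + j)))
        * det (sq_mat_upto \<lfloor>(real n - 1) / 2\<rfloor> (\<lambda>i j. c (i + j + 1)))" for n
    unfolding sq_mat_upto_def size even_size odd_size by (rule det_hankel_aerate)
  then show ?thesis
    by (simp add: hankel_transform_def shift_seq_def)
qed

end
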